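(* Let $-D\le C<D\le 1$ and let $f(z)=z+\sum_{m=2}^{\infty}a_m z^m+\overline{\sum_{m=2}^{\infty}b_m z^m}\in\mathcal{S}^{**}_{\tau}(C,D)$. Then $$r-\frac{D-C}{2(1+D)}r^2\le|f(z)|\le r+\frac{D-C}{2(1+D)}r^2\qquad(|z|=r<1)$$ and $$|z|+\sum_{m=2}^\infty(|a_m|+|b_m|)|z|^m\le d(f(0),\partial f(\mathbb{D}))$$ for $|z|\le r^*$, where, with $\alpha_2=2(1+D)$, $$r^*=\frac{-1+\sqrt{1+4\left(\frac{D-C}{\alpha_2}\right)\left(1-\frac{D-C}{\alpha_2}\right)}}{2\left(\frac{D-C}{\alpha_2}\right)}.$$ The radius $r^*$ is the Bohr radius of the class (the largest radius for which the last inequality holds for all members of $\mathcal{S}^{**}_{\tau}(C,D)$), and it is achieved by the function $f(z)=z-\frac{D-C}{2(1+D)}z^2$.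
   Context: $\mathbb{D}=\{z\in\mathbb{C}:|z|<1\}$; $d(f(0),\partial f(\mathbb{D}))$ is the Euclidean distance from $f(0)$ to the boundary of $f(\mathbb{D})$. $\mathcal{H}_0$ is the class of complex-valued harmonic functions $f=h+\bar g$ on $\mathbb{D}$ with $h(z)=z+\sum_{m=2}^\infty a_mz^m$ and $g(z)=\sum_{m=2}^\infty b_mz^m$ analytic in $\mathbb{D}$. $\tau^0$ is the class of those $f\in\mathcal{H}_0$ with $a_m=-|a_m|$ and $b_m=|b_m|$ for all $m\ge2$. For $f\in\mathcal{H}_0$ put $\mathcal{D}_{\mathcal{H}}f(z)=zh'(z)-\overline{zg'(z)}$. For a function $q$ on $\mathbb{D}$ and a univalent analytic $\phi$ on $\mathbb{D}$, $q\prec\phi$ means $q(0)=\phi(0)$ and $q(\mathbb{D})\subseteq\phi(\mathbb{D})$. $\mathcal{S}^{**}_{\mathcal{H}}(C,D)$ is the class of $f\in\mathcal{H}_0$ such that $\frac{2\mathcal{D}_{\mathcal{H}}f(z)}{f(z)-f(-z)}\prec\frac{1+Cz}{1+Dz}$ (the quotient being well defined on $\mathbb{D}\setminus\{0\}$ and taken to be $1$ at $z=0$), and $\mathcal{S}^{**}_\tau(C,D)=\tau^0\cap\mathcal{S}^{**}_{\mathcal{H}}(C,D)$. *)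

theory Defs
  imports "HOL-Complex_Analysis.Complex_Analysis"
begin

(* A function on the unit disc is a total function of type complex => complex of which only the
   values on ball 0 1 are used. A coefficient sequence is a :: nat => complex of which only the
   values a m with m >= 2 are used. *)

definition analytic_part :: "(nat \<Rightarrow> complex) \<Rightarrow> complex \<Rightarrow> complex" where
  "analytic_part a z = z + (\<Sum>m. a (m + 2) * z ^ (m + 2))"

definition coanalytic_part :: "(nat \<Rightarrow> complex) \<Rightarrow> complex \<Rightarrow> complex" where
  "coanalytic_part b z = (\<Sum>m. b (m + 2) * z ^ (m + 2))"

(* f = h + cnj g on the disc, with h(z) = z + sum_{m >= 2} a_m z^m and g(z) = sum_{m >= 2} b_m z^m.
   Convergence of both series on the disc is what makes h and g analytic there.
   The values a m, b m for m >= 2 are uniquely determined by f, because g(0) = 0; hence it does not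
   matter below whether a and b are bound existentially or universally. *)
definition harmonic_expansion ::
    "(complex \<Rightarrow> complex) \<Rightarrow> (nat \<Rightarrow> complex) \<Rightarrow> (nat \<Rightarrow> complex) \<Rightarrow> bool" where
  "harmonic_expansion f a b \<longleftrightarrow>
     (\<forall>z\<in>ball 0 1. summable (\<lambda>m. a (m + 2) * z ^ (m + 2)) \<and>
                   summable (\<lambda>m. b (m + 2) * z ^ (m + 2)) \<and>
                   f z = analytic_part a z + cnj (coanalytic_part b z))"

definition harmonic_class :: "(complex \<Rightarrow> complex) set" where
  "harmonic_class = {f. \<exists>a b. harmonic_expansion f a b}"

definition tau_class :: "(complex \<Rightarrow> complex) set" where
  "tau_class = {f. \<exists>a b. harmonic_expansion f a b \<and>
     (\<forall>m\<ge>2. a m = - complex_of_real (cmod (a m)) \<and> b m = complex_of_real (cmod (b m)))}"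

definition harmonic_diff ::
    "(complex \<Rightarrow> complex) \<Rightarrow> (complex \<Rightarrow> complex) \<Rightarrow> complex \<Rightarrow> complex" where
  "harmonic_diff h g z = z * deriv h z - cnj (z * deriv g z)"

(* Subordination to a function phi that is analytic and univalent on the disc. *)
definition subordinate :: "(complex \<Rightarrow> complex) \<Rightarrow> (complex \<Rightarrow> complex) \<Rightarrow> bool" where
  "subordinate q \<phi> \<longleftrightarrow> q 0 = \<phi> 0 \<and> q ` ball 0 1 \<subseteq> \<phi> ` ball 0 1"

(* The condition f z - f (- z) \<noteq> 0 says that the quotient is well defined off 0; it has to be
   explicit because division by zero yields 0 in HOL. *)
definition SH_class :: "real \<Rightarrow> real \<Rightarrow> (complex \<Rightarrow> complex) set" where
  "SH_class C D = {f \<in> harmonic_class. \<exists>a b. harmonic_expansion f a b \<and>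
     (\<forall>z\<in>ball 0 1 - {0}. f z - f (- z) \<noteq> 0) \<and>
     subordinate
       (\<lambda>z. if z = 0 then 1
             else 2 * harmonic_diff (analytic_part a) (coanalytic_part b) z / (f z - f (- z)))
       (\<lambda>z. (1 + complex_of_real C * z) / (1 + complex_of_real D * z))}"

definition Stau_class :: "real \<Rightarrow> real \<Rightarrow> (complex \<Rightarrow> complex) set" where
  "Stau_class C D = tau_class \<inter> SH_class C D"

definition majorant :: "(nat \<Rightarrow> complex) \<Rightarrow> (nat \<Rightarrow> complex) \<Rightarrow> complex \<Rightarrow> real" where
  "majorant a b z = cmod z + (\<Sum>m. (cmod (a (m + 2)) + cmod (b (m + 2))) * cmod z ^ (m + 2))"

(* The image of the disc is never all of the plane for the functions considered here, so the
   convention infdist x {} = 0 plays no role. *)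
definition boundary_dist :: "(complex \<Rightarrow> complex) \<Rightarrow> real" where
  "boundary_dist f = infdist (f 0) (frontier (f ` ball 0 1))"

definition Bohr_inequality_upto :: "(complex \<Rightarrow> complex) set \<Rightarrow> real \<Rightarrow> bool" where
  "Bohr_inequality_upto F R \<longleftrightarrow>
     (\<forall>f\<in>F. \<forall>a b. harmonic_expansion f a b \<longrightarrow>
        (\<forall>z\<in>ball 0 1. cmod z \<le> R \<longrightarrow> majorant a b z \<le> boundary_dist f))"

definition is_Bohr_radius :: "(complex \<Rightarrow> complex) set \<Rightarrow> real \<Rightarrow> bool" where
  "is_Bohr_radius F R \<longleftrightarrow>
     R \<in> {0..1} \<and> Bohr_inequality_upto F R \<and>
     (\<forall>R'\<in>{0..1}. Bohr_inequality_upto F R' \<longrightarrow> R' \<le> R)"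

definition alpha2 :: "real \<Rightarrow> real" where
  "alpha2 D = 2 * (1 + D)"

definition r_star :: "real \<Rightarrow> real \<Rightarrow> real" where
  "r_star C D =
     (- 1 + sqrt (1 + 4 * ((D - C) / alpha2 D) * (1 - (D - C) / alpha2 D)))
       / (2 * ((D - C) / alpha2 D))"

definition extremal_fun :: "real \<Rightarrow> real \<Rightarrow> complex \<Rightarrow> complex" where
  "extremal_fun C D z = z - complex_of_real ((D - C) / (2 * (1 + D))) * z ^ 2"

end

theory Submission
  imports Defs
begin

text \<open>
  Write \<open>k = (D - C) / (2 * (1 + D))\<close>. For \<open>z = r\<close> in \<open>(0,1)\<close> the sign conditions on the
  coefficients make the subordinate quotient real, so it exceeds \<open>(1 + C) / (1 + D)\<close>, the left
  end of the real trace of the image of the disc under \<open>(1 + C * z) / (1 + D * z)\<close>. Clearing the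
  denominator and letting \<open>r\<close> tend to \<open>1\<close> gives \<open>\<Sum> (|a_m| + |b_m|) \<le> k\<close>, hence
  \<open>|f z - z| \<le> k * |z|^2\<close>. This yields the growth estimate, and Brouwer's fixed point theorem,
  applied to \<open>z \<mapsto> w + z - f z\<close>, shows that the image of \<open>f\<close> contains the disc of
  radius \<open>1 - k\<close>. The Bohr inequality thus reduces to \<open>r + k * r^2 \<le> 1 - k\<close>, and \<open>r_star\<close> is the
  positive root of the corresponding equation. For the extremal function, \<open>1 - k\<close> is a boundary
  value that is not attained in the disc.
\<close>

section \<open>Power series on the unit disc\<close>

definition disc_summable :: "(nat \<Rightarrow> complex) \<Rightarrow> bool" where
  "disc_summable a \<longleftrightarrow> (\<forall>z\<in>ball 0 1. summable (\<lambda>m. a (m + 2) * z ^ (m + 2)))"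

text \<open>Padding with zeros at the indices 0 and 1 turns the shifted series into an ordinary
  power series, the form in which the library states absolute convergence, termwise differentiation
  and isolation of zeros.\<close>

definition tail2 :: "(nat \<Rightarrow> complex) \<Rightarrow> nat \<Rightarrow> complex" where
  "tail2 a n = (if n < 2 then 0 else a n)"

lemma tail2_sums:
  assumes "disc_summable a" "cmod z < 1"
  shows "(\<lambda>n. tail2 a n * z ^ n) sums coanalytic_part a z"
proof -
  have "summable (\<lambda>m. a (m + 2) * z ^ (m + 2))"
    using assms by (auto simp: disc_summable_def)
  then have "(\<lambda>m. tail2 a (m + 2) * z ^ (m + 2)) sums coanalytic_part a z"
    by (simp add: coanalytic_part_def tail2_def summable_sums del: power_Suc)
  then show ?thesis
    by (subst (asm) sums_zero_iff_shift) (auto simp: tail2_def)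
qed

text \<open>Convergence at some \<open>x\<close> strictly between \<open>r\<close> and 1 forces
  absolute convergence at \<open>r\<close>.\<close>

lemma disc_summable_norm:
  assumes "disc_summable a" "0 \<le> r" "r < 1"
  shows "summable (\<lambda>m. cmod (a (m + 2)) * r ^ (m + 2))"
proof -
  obtain x where x: "r < x" "x < 1" using dense[OF assms(3)] by blast
  have "summable (\<lambda>n. tail2 a n * complex_of_real x ^ n)"
    using tail2_sums[OF assms(1), of "of_real x"] x assms(2) by (auto simp: sums_iff)
  then have "summable (\<lambda>n. norm (tail2 a n * complex_of_real r ^ n))"
    by (rule powser_insidea) (use x assms in auto)
  then have "summable (\<lambda>n. norm (tail2 a (n + 2) * complex_of_real r ^ (n + 2)))"
    by (rule summable_ignore_initial_segment)
  then show ?thesis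
    using assms(2) by (simp add: tail2_def norm_mult norm_power del: power_Suc)
qed

lemma coanalytic_part_DERIV:
  assumes "disc_summable a" "cmod z < 1"
  shows "(coanalytic_part a has_field_derivative deriv (coanalytic_part a) z) (at z)"
    and "(\<lambda>m. of_nat (m + 2) * a (m + 2) * z ^ (m + 1)) sums deriv (coanalytic_part a) z"
proof -
  let ?F = "\<lambda>z. \<Sum>n. tail2 a n * z ^ n"
  have ev: "\<forall>\<^sub>F w in nhds z. ?F w = coanalytic_part a w"
  proof -
    have "\<forall>\<^sub>F w in nhds z. w \<in> ball 0 1"
      using assms(2) by (intro eventually_nhds_in_open) auto
    then show ?thesis
      by eventually_elim (use tail2_sums[OF assms(1)] in \<open>auto simp: sums_iff\<close>)
  qed
  have "(?F has_field_derivative (\<Sum>n. diffs (tail2 a) n * z ^ n)) (at z)"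
    using tail2_sums[OF assms(1)] assms(2)
    by (intro termdiffs_strong'[of 1]) (auto simp: sums_iff)
  then have *: "(coanalytic_part a has_field_derivative (\<Sum>n. diffs (tail2 a) n * z ^ n)) (at z)"
    using DERIV_cong_ev[OF refl ev refl] by simp
  then show D: "(coanalytic_part a has_field_derivative deriv (coanalytic_part a) z) (at z)"
    by (simp add: DERIV_imp_deriv)
  have "(\<lambda>n. diffs (tail2 a) n * z ^ n) sums deriv (coanalytic_part a) z"
    by (rule termdiffs_sums_strong[OF _ D assms(2)]) (rule tail2_sums[OF assms(1)])
  \<comment> \<open>The derived series has constant term \<open>tail2 a 1 = 0\<close>, so it may
    start at the first power of \<open>z\<close>.\<close>
  then have "(\<lambda>n. diffs (tail2 a) (n + 1) * z ^ (n + 1)) sums deriv (coanalytic_part a) z"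
    by (subst sums_zero_iff_shift) (auto simp: diffs_def tail2_def)
  then show "(\<lambda>m. of_nat (m + 2) * a (m + 2) * z ^ (m + 1)) sums deriv (coanalytic_part a) z"
    by (simp add: diffs_def tail2_def del: power_Suc)
qed

lemma coanalytic_part_0 [simp]: "coanalytic_part a 0 = 0"
  by (simp add: coanalytic_part_def)

lemma analytic_part_eq: "analytic_part a z = z + coanalytic_part a z"
  by (simp add: analytic_part_def coanalytic_part_def)

lemma deriv_analytic_part:
  assumes "disc_summable a" "cmod z < 1"
  shows "deriv (analytic_part a) z = 1 + deriv (coanalytic_part a) z"
proof (rule DERIV_imp_deriv)
  show "(analytic_part a has_field_derivative 1 + deriv (coanalytic_part a) z) (at z)"
    unfolding analytic_part_eq[abs_def]
    by (intro DERIV_add DERIV_ident coanalytic_part_DERIV assms)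
qed

section \<open>Uniqueness of the harmonic expansion\<close>

lemma coanalytic_part_diff:
  assumes "disc_summable a" "disc_summable b" "cmod z < 1"
  shows "coanalytic_part (\<lambda>m. a m - b m) z = coanalytic_part a z - coanalytic_part b z"
  using assms suminf_diff[of "\<lambda>m. a (m + 2) * z ^ (m + 2)" "\<lambda>m. b (m + 2) * z ^ (m + 2)"]
  by (simp add: disc_summable_def coanalytic_part_def left_diff_distrib del: power_Suc)

lemma disc_summable_diff:
  "disc_summable a \<Longrightarrow> disc_summable b \<Longrightarrow> disc_summable (\<lambda>m. a m - b m)"
  using summable_diff
  by (fastforce simp: disc_summable_def left_diff_distrib simp del: power_Suc)

text \<open>A nonzero coefficient would make the zero at the origin isolated, contradicting
  vanishing on the whole disc.\<close>

lemma coanalytic_part_zero_coeff: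
  assumes "disc_summable a" "\<And>z. cmod z < 1 \<Longrightarrow> coanalytic_part a z = 0" "2 \<le> m"
  shows "a m = 0"
proof (rule ccontr)
  assume "a m \<noteq> 0"
  then have ne: "tail2 a m \<noteq> 0" "0 < m" using assms(3) by (auto simp: tail2_def)
  have s: "(\<lambda>n. tail2 a n * (x - 0) ^ n) sums coanalytic_part a x" if "cmod (x - 0) < 1" for x
    using tail2_sums[OF assms(1)] that by simp
  obtain s where s: "0 < s" "\<And>z. z \<in> cball 0 s - {0} \<Longrightarrow> coanalytic_part a z \<noteq> 0"
    using powser_0_nonzero[OF zero_less_one s coanalytic_part_0 ne] by metis
  define z where "z = complex_of_real (min s (1/2))"
  have "z \<in> cball 0 s - {0}" "cmod z < 1"
    using s(1) by (auto simp: z_def min_def)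
  with s(2) assms(2) show False by blast
qed

text \<open>If holomorphic functions satisfy \<open>h = - cnj g\<close>, comparing the real derivatives in the
  directions \<open>1\<close> and \<open>\<i>\<close> gives \<open>h' = - cnj g'\<close> and \<open>h' = cnj g'\<close>.\<close>

lemma holomorphic_eq_cnj_imp_deriv_0:
  assumes "open S" "z \<in> S" "\<And>w. w \<in> S \<Longrightarrow> h w + cnj (g w) = 0"
    and h: "(h has_field_derivative h') (at z)" and g: "(g has_field_derivative g') (at z)"
  shows "h' = 0" "g' = 0"
proof -
  have "((\<lambda>w. h w + cnj (g w)) has_derivative (\<lambda>v. h' * v + cnj (g' * v))) (at z)"
    using h g by (auto intro!: derivative_eq_intros simp: has_field_derivative_def)
  moreover have "((\<lambda>w. h w + cnj (g w)) has_derivative (\<lambda>v. 0)) (at z)"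
    by (rule has_derivative_transform_within_open[OF has_derivative_const assms(1,2)])
      (simp add: assms(3))
  ultimately have *: "(\<lambda>v. h' * v + cnj (g' * v)) = (\<lambda>v. 0)"
    by (rule has_derivative_unique)
  have "h' + cnj g' = 0" "h' * \<i> - cnj g' * \<i> = 0"
    using fun_cong[OF *, of 1] fun_cong[OF *, of "\<i>"] by auto
  then have "h' + cnj g' = 0" "h' = cnj g'" by (auto simp flip: left_diff_distrib)
  then show "h' = 0" "g' = 0" by auto
qed

lemma coanalytic_part_eq_0:
  assumes "disc_summable a" "\<And>z. cmod z < 1 \<Longrightarrow> deriv (coanalytic_part a) z = 0" "cmod z < 1"
  shows "coanalytic_part a z = 0"
proof -
  have "\<exists>c. \<forall>x\<in>ball 0 1. coanalytic_part a x = c"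
  proof (rule has_field_derivative_zero_constant)
    fix x :: complex assume "x \<in> ball 0 1"
    then show "(coanalytic_part a has_field_derivative 0) (at x within ball 0 1)"
      using coanalytic_part_DERIV(1)[OF assms(1), of x] assms(2)[of x]
      by (auto intro: has_field_derivative_at_within)
  qed auto
  then show ?thesis using assms(3) by (metis coanalytic_part_0 dist_0_norm mem_ball norm_zero zero_less_one)
qed

lemma harmonic_expansion_iff:
  "harmonic_expansion f a b \<longleftrightarrow> disc_summable a \<and> disc_summable b \<and>
     (\<forall>z. cmod z < 1 \<longrightarrow> f z = z + coanalytic_part a z + cnj (coanalytic_part b z))"
  by (auto simp: harmonic_expansion_def disc_summable_def analytic_part_eq)

text \<open>The differences of the coefficients define holomorphic \<open>p\<close> and
  \<open>q\<close> with \<open>p + cnj q = 0\<close>, so both derivatives vanish; both functions are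
  0 at 0, hence identically 0. This makes it possible to carry properties from the coefficients
  bound existentially in the classes to any given \<open>a\<close> and \<open>b\<close>.\<close>

lemma harmonic_expansion_unique:
  assumes "harmonic_expansion f a b" "harmonic_expansion f a' b'" "2 \<le> m"
  shows "a m = a' m" "b m = b' m"
proof -
  define p q where "p = (\<lambda>m. a m - a' m)" and "q = (\<lambda>m. b m - b' m)"
  have S: "disc_summable p" "disc_summable q"
    using assms(1,2) by (auto simp: p_def q_def harmonic_expansion_iff intro: disc_summable_diff)
  have z: "coanalytic_part p z + cnj (coanalytic_part q z) = 0" if "z \<in> ball 0 1" for z
    using assms(1,2) that by (auto simp: harmonic_expansion_iff p_def q_def coanalytic_part_diff algebra_simps)
  have "deriv (coanalytic_part p) z = 0 \<and> deriv (coanalytic_part q) z = 0" if "cmod z < 1" for z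
    using holomorphic_eq_cnj_imp_deriv_0[OF open_ball[of 0 1] _ z
        coanalytic_part_DERIV(1)[OF S(1) that] coanalytic_part_DERIV(1)[OF S(2) that]] that
    by auto
  then have "p m = 0" "q m = 0"
    using coanalytic_part_zero_coeff[OF S(1)] coanalytic_part_zero_coeff[OF S(2)]
      coanalytic_part_eq_0[OF S(1)] coanalytic_part_eq_0[OF S(2)] assms(3) by auto
  then show "a m = a' m" "b m = b' m" by (auto simp: p_def q_def)
qed

lemma coanalytic_part_cong:
  "(\<And>m. 2 \<le> m \<Longrightarrow> a m = a' m) \<Longrightarrow> coanalytic_part a = coanalytic_part a'"
  by (simp add: coanalytic_part_def fun_eq_iff)

lemma analytic_part_cong:
  "(\<And>m. 2 \<le> m \<Longrightarrow> a m = a' m) \<Longrightarrow> analytic_part a = analytic_part a'"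
  using coanalytic_part_cong[of a a'] by (simp add: analytic_part_eq fun_eq_iff)

section \<open>Real points and the coefficient bound\<close>

lemma real_coeffs_sums:
  assumes "disc_summable a" "\<And>m. 2 \<le> m \<Longrightarrow> a m = complex_of_real (\<alpha> m)" "\<bar>x\<bar> < 1"
  shows "\<exists>P. (\<lambda>m. \<alpha> (m + 2) * x ^ (m + 2)) sums P \<and> coanalytic_part a (of_real x) = of_real P"
    and "\<exists>Q. (\<lambda>m. real (m + 2) * \<alpha> (m + 2) * x ^ (m + 1)) sums Q \<and>
      deriv (coanalytic_part a) (of_real x) = of_real Q"
proof -
  have x: "cmod (complex_of_real x) < 1" using assms(3) by simp
  have "(\<lambda>m. a (m + 2) * complex_of_real x ^ (m + 2)) sums coanalytic_part a (of_real x)"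
    using assms(1) x by (simp add: coanalytic_part_def disc_summable_def summable_sums del: power_Suc)
  then have 1: "(\<lambda>m. complex_of_real (\<alpha> (m + 2) * x ^ (m + 2))) sums coanalytic_part a (of_real x)"
    by (simp add: assms(2))
  have 2: "(\<lambda>m. complex_of_real (real (m + 2) * \<alpha> (m + 2) * x ^ (m + 1)))
      sums deriv (coanalytic_part a) (of_real x)"
    using coanalytic_part_DERIV(2)[OF assms(1) x] by (simp add: assms(2) algebra_simps)
  \<comment> \<open>The imaginary parts of a real series sum to 0, so a complex sum of real terms is
    real.\<close>
  have real: "s = of_real (Re s)" if "(\<lambda>m. complex_of_real (u m)) sums s" for u s
  proof -
    have "(\<lambda>m. 0) sums Im s" using sums_Im[OF that] by simp
    then have "Im s = 0" by (metis sums_unique2 sums_zero)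
    then show ?thesis by (simp add: complex_eq_iff)
  qed
  show "\<exists>P. (\<lambda>m. \<alpha> (m + 2) * x ^ (m + 2)) sums P \<and> coanalytic_part a (of_real x) = of_real P"
    using sums_Re[OF 1, unfolded Re_complex_of_real] real[OF 1]
    by (intro exI[of _ "Re (coanalytic_part a (of_real x))"] conjI)
  show "\<exists>Q. (\<lambda>m. real (m + 2) * \<alpha> (m + 2) * x ^ (m + 1)) sums Q \<and>
      deriv (coanalytic_part a) (of_real x) = of_real Q"
    using sums_Re[OF 2, unfolded Re_complex_of_real] real[OF 2]
    by (intro exI[of _ "Re (deriv (coanalytic_part a) (of_real x))"] conjI)
qed

text \<open>For nonnegative terms each partial sum at \<open>r < 1\<close> is at most the full sum,
  hence at most \<open>K\<close>. A partial sum is a polynomial in \<open>r\<close>, so the bound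
  survives the limit \<open>r\<close> to 1 from the left.\<close>

lemma Abel_bound:
  fixes p :: "nat \<Rightarrow> real"
  assumes "\<And>m. 0 \<le> p m"
    and "\<And>r. 0 < r \<Longrightarrow> r < 1 \<Longrightarrow> summable (\<lambda>m. p m * r ^ (m + 1)) \<and> (\<Sum>m. p m * r ^ (m + 1)) \<le> K"
  shows "summable p" "suminf p \<le> K"
proof -
  have bound: "sum p {..<n} \<le> K" for n
  proof (rule tendsto_upperbound)
    show "((\<lambda>r. \<Sum>m<n. p m * r ^ (m + 1)) \<longlongrightarrow> sum p {..<n}) (at_left 1)"
      by (auto intro!: tendsto_eq_intros)
    have "(\<Sum>m<n. p m * r ^ (m + 1)) \<le> K" if "0 < r" "r < 1" for r
      using assms(2)[OF that] sum_le_suminf[of "\<lambda>m. p m * r ^ (m + 1)" "{..<n}"] assms(1) that(1)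
      by fastforce
    then show "\<forall>\<^sub>F r in at_left 1. (\<Sum>m<n. p m * r ^ (m + 1)) \<le> K"
      using eventually_at_left_real[of 0 "1::real"] by (auto elim: eventually_mono)
  qed simp
  show "summable p"
    by (rule summableI_nonneg_bounded[OF assms(1) bound])
  then show "suminf p \<le> K"
    using bound by (rule suminf_le_const)
qed

text \<open>Solving for \<zeta> gives \<open>w - 1 = (C - w * D) * \<zeta>\<close>. If
  \<open>w\<close> were at most \<open>(1 + C) / (1 + D)\<close>, then
  \<open>\<bar>C - w * D\<bar> \<le> 1 - w\<close> with \<open>w < 1\<close>, which is incompatible
  with \<open>cmod \<zeta> < 1\<close>.\<close>

lemma real_in_janowski_image:
  fixes C D w :: real
  assumes "- D \<le> C" "C < D" "D \<le> 1" "cmod \<zeta> < 1"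
    and eq: "complex_of_real w = (1 + of_real C * \<zeta>) / (1 + of_real D * \<zeta>)"
  shows "1 + C < (1 + D) * w"
proof (rule ccontr)
  assume "\<not> ?thesis"
  then have le: "(1 + D) * w \<le> 1 + C" by simp
  have D: "0 < D" using assms by simp
  have "D * cmod \<zeta> \<le> cmod \<zeta>" using D assms(3) by (intro mult_left_le_one_le) auto
  then have "cmod (of_real D * \<zeta>) < 1" using assms(4) D by (simp add: norm_mult)
  then have "1 + of_real D * \<zeta> \<noteq> 0"
    by (metis add_eq_0_iff norm_minus_cancel norm_one less_irrefl)
  with eq have "complex_of_real (w - 1) = of_real (C - w * D) * \<zeta>"
    by (simp add: field_simps)
  then have n: "\<bar>w - 1\<bar> = \<bar>C - w * D\<bar> * cmod \<zeta>"
    by (metis norm_mult norm_of_real)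
  have w1: "w < 1"
    using le D assms by (smt (verit) mult_le_cancel_left1)
  \<comment> \<open>The next two inequalities are the upper and lower halves of
    \<open>\<bar>C - w * D\<bar> \<le> 1 - w\<close>.\<close>
  have "(1 + D) * (w * (1 - D)) \<le> (1 + C) * (1 - D)"
    using mult_right_mono[OF le, of "1 - D"] assms(3) by (simp add: algebra_simps)
  also have "\<dots> \<le> (1 + D) * (1 - C)" using assms by (simp add: algebra_simps)
  finally have "w * (1 - D) \<le> 1 - C" using D by simp
  moreover have "w * D - C \<le> 1 - w" using le by (simp add: algebra_simps)
  ultimately have "\<bar>C - w * D\<bar> \<le> 1 - w" by (simp add: algebra_simps abs_le_iff)
  then have "\<bar>C - w * D\<bar> * cmod \<zeta> \<le> (1 - w) * cmod \<zeta>"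
    by (intro mult_right_mono) auto
  also have "\<dots> < 1 - w" using w1 assms(4) by simp
  finally show False using n w1 by simp
qed

lemma Stau_classD:
  assumes "f \<in> Stau_class C D" "harmonic_expansion f a b"
  shows "\<And>m. 2 \<le> m \<Longrightarrow> a m = of_real (- cmod (a m))"
    and "\<And>m. 2 \<le> m \<Longrightarrow> b m = of_real (cmod (b m))"
    and "\<And>z. cmod z < 1 \<Longrightarrow> z \<noteq> 0 \<Longrightarrow> f z - f (- z) \<noteq> 0 \<and>
      (\<exists>\<zeta>. cmod \<zeta> < 1 \<and>
        2 * harmonic_diff (analytic_part a) (coanalytic_part b) z / (f z - f (- z))
          = (1 + of_real C * \<zeta>) / (1 + of_real D * \<zeta>))"
proof -
  obtain a1 b1 where 1: "harmonic_expansion f a1 b1"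
    "\<forall>m\<ge>2. a1 m = - complex_of_real (cmod (a1 m)) \<and> b1 m = complex_of_real (cmod (b1 m))"
    using assms(1) by (auto simp: Stau_class_def tau_class_def)
  show "a m = of_real (- cmod (a m))" "b m = of_real (cmod (b m))" if "2 \<le> m" for m
    using 1(2) that harmonic_expansion_unique[OF assms(2) 1(1) that] by auto
next
  fix z :: complex assume z: "cmod z < 1" "z \<noteq> 0"
  obtain a1 b1 where 1: "harmonic_expansion f a1 b1"
    "\<forall>z\<in>ball 0 1 - {0}. f z - f (- z) \<noteq> 0"
    "(\<lambda>z. if z = 0 then 1
       else 2 * harmonic_diff (analytic_part a1) (coanalytic_part b1) z / (f z - f (- z))) ` ball 0 1
       \<subseteq> (\<lambda>z. (1 + complex_of_real C * z) / (1 + complex_of_real D * z)) ` ball 0 1"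
    using assms(1) by (auto simp: Stau_class_def SH_class_def subordinate_def)
  have eq: "analytic_part a1 = analytic_part a" "coanalytic_part b1 = coanalytic_part b"
    using harmonic_expansion_unique[OF 1(1) assms(2)]
    by (auto intro: analytic_part_cong coanalytic_part_cong)
  have "z \<in> ball 0 1" using z by simp
  from subsetD[OF 1(3) imageI[OF this]] 1(2) z
  show "f z - f (- z) \<noteq> 0 \<and> (\<exists>\<zeta>. cmod \<zeta> < 1 \<and>
        2 * harmonic_diff (analytic_part a) (coanalytic_part b) z / (f z - f (- z))
          = (1 + of_real C * \<zeta>) / (1 + of_real D * \<zeta>))"
    by (auto simp: eq)
qed

lemma Stau_coeff_bound:
  assumes CD: "- D \<le> C" "C < D" "D \<le> 1"
    and f: "f \<in> Stau_class C D" "harmonic_expansion f a b"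
  defines "p \<equiv> \<lambda>m. cmod (a (m + 2)) + cmod (b (m + 2))"
  shows "summable p" "suminf p \<le> (D - C) / (2 * (1 + D))"
proof -
  \<comment> \<open>The difference \<open>f x - f (- x)\<close> keeps only odd powers. Index
    \<open>m\<close> belongs to the power \<open>m + 2\<close>, so these are the odd
    \<open>m\<close>; the signs come from \<open>a m = - cmod (a m)\<close> and
    \<open>b m = cmod (b m)\<close>.\<close>
  define c where "c m = (if odd m then cmod (b (m + 2)) - cmod (a (m + 2)) else 0)" for m
  text \<open>\<open>y x\<close> is \<open>(f x - f (- x)) / (2 * x)\<close>, continued to \<open>x = 0\<close>. It is positive
    on \<open>[0,1)\<close> because it does not vanish and \<open>y 0 = 1\<close>.\<close>
  define y where "y x = 1 + x * (\<Sum>m. c m * x ^ m)" for x :: real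
  have D: "0 < D" using CD by simp
  have ds: "disc_summable a" "disc_summable b"
    and fz: "\<And>z. cmod z < 1 \<Longrightarrow> f z = z + coanalytic_part a z + cnj (coanalytic_part b z)"
    using f(2) by (auto simp: harmonic_expansion_iff)
  note re = Stau_classD(1,2)[OF f]
  have summ: "summable (\<lambda>m. p m * x ^ m)" and sumc: "summable (\<lambda>m. c m * x ^ m)"
    if "0 < x" "x < 1" for x
  proof -
    have "summable (\<lambda>m. (cmod (a (m + 2)) * x ^ (m + 2) + cmod (b (m + 2)) * x ^ (m + 2)) / x ^ 2)"
      using that by (intro summable_divide summable_add disc_summable_norm ds) auto
    then show *: "summable (\<lambda>m. p m * x ^ m)"
      using that by (simp add: p_def power2_eq_square algebra_simps add_divide_distrib)
    show "summable (\<lambda>m. c m * x ^ m)"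
    proof (rule summable_comparison_test'[OF *, of 0])
      show "norm (c m * x ^ m) \<le> p m * x ^ m" for m
      proof -
        have "\<bar>c m\<bar> \<le> p m"
          using norm_ge_zero[of "a (m + 2)"] norm_ge_zero[of "b (m + 2)"]
          by (simp add: c_def p_def abs_le_iff)
        then show ?thesis using that by (auto simp: abs_mult intro!: mult_right_mono)
      qed
    qed
  qed
  have key: "summable (\<lambda>m. p m * r ^ (m + 1)) \<and>
      (\<Sum>m. p m * r ^ (m + 1)) \<le> (D - C) / (2 * (1 + D))" if r: "0 < r" "r < 1" for r
  proof -
    have fdiff: "f (of_real x) - f (- of_real x) = of_real (2 * x * y x)" if x: "0 < x" "x < 1" for x
    proof -
      have x1: "\<bar>x\<bar> < 1" "\<bar>- x\<bar> < 1" using x by auto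
      obtain P where P: "(\<lambda>m. - cmod (a (m + 2)) * x ^ (m + 2)) sums P"
        "coanalytic_part a (of_real x) = of_real P"
        using real_coeffs_sums(1)[OF ds(1) re(1) x1(1)] by blast
      obtain Q where Q: "(\<lambda>m. cmod (b (m + 2)) * x ^ (m + 2)) sums Q"
        "coanalytic_part b (of_real x) = of_real Q"
        using real_coeffs_sums(1)[OF ds(2) re(2) x1(1)] by blast
      obtain P' where P': "(\<lambda>m. - cmod (a (m + 2)) * (- x) ^ (m + 2)) sums P'"
        "coanalytic_part a (of_real (- x)) = of_real P'"
        using real_coeffs_sums(1)[OF ds(1) re(1) x1(2)] by blast
      obtain Q' where Q': "(\<lambda>m. cmod (b (m + 2)) * (- x) ^ (m + 2)) sums Q'"
        "coanalytic_part b (of_real (- x)) = of_real Q'"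
        using real_coeffs_sums(1)[OF ds(2) re(2) x1(2)] by blast
      have "(\<lambda>m. - cmod (a (m + 2)) * x ^ (m + 2) + cmod (b (m + 2)) * x ^ (m + 2)
          - (- cmod (a (m + 2)) * (- x) ^ (m + 2) + cmod (b (m + 2)) * (- x) ^ (m + 2)))
          sums (P + Q - (P' + Q'))"
        by (intro sums_add sums_diff P Q P' Q')
      moreover have "(\<lambda>m. - cmod (a (m + 2)) * x ^ (m + 2) + cmod (b (m + 2)) * x ^ (m + 2)
          - (- cmod (a (m + 2)) * (- x) ^ (m + 2) + cmod (b (m + 2)) * (- x) ^ (m + 2)))
          = (\<lambda>m. 2 * x ^ 2 * (c m * x ^ m))"
        by (auto simp: fun_eq_iff c_def power2_eq_square algebra_simps)
      moreover have "(\<lambda>m. 2 * x ^ 2 * (c m * x ^ m)) sums (2 * x ^ 2 * (\<Sum>m. c m * x ^ m))"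
        by (intro sums_mult summable_sums sumc x)
      ultimately have "P + Q - (P' + Q') = 2 * x ^ 2 * (\<Sum>m. c m * x ^ m)"
        using sums_unique2 by metis
      moreover have "f (of_real x) - f (- of_real x) = of_real (2 * x + (P + Q - (P' + Q')))"
        using x fz[of "of_real x"] fz[of "- of_real x"] P(2) Q(2) P'(2) Q'(2) by simp
      ultimately show ?thesis
        by (simp add: y_def power2_eq_square algebra_simps)
    qed
    have ynz: "y x \<noteq> 0" if "0 \<le> x" "x < 1" for x
    proof (cases "x = 0")
      case False
      then have "f (of_real x) - f (- of_real x) \<noteq> 0"
        using Stau_classD(3)[OF f, of "of_real x"] that by simp
      then show ?thesis using fdiff[of x] that False by auto
    qed (simp add: y_def)
    have "0 < y r"
    proof (rule ccontr)
      assume "\<not> 0 < y r"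
      then have "y r \<le> 0" by simp
      moreover have "continuous_on {0..r} y"
      proof -
        \<comment> \<open>Continuity of the power series at a point up to \<open>r\<close> is
          deduced from convergence at a strictly larger \<open>K\<close>.\<close>
        obtain K where K: "r < K" "K < 1" using dense[OF r(2)] by blast
        have "isCont (\<lambda>x. \<Sum>m. c m * x ^ m) x" if "0 \<le> x" "x \<le> r" for x
          by (rule isCont_powser[OF sumc[of K]]) (use K r that in auto)
        then show ?thesis
          unfolding y_def by (intro continuous_intros continuous_at_imp_continuous_on) auto
      qed
      ultimately obtain x where "0 \<le> x" "x \<le> r" "y x = 0"
        using IVT2'[of y r 0 0] r by (auto simp: y_def)
      then show False using ynz[of x] r by simp
    qed
    have r1: "\<bar>r\<bar> < 1" using r by simp
    obtain P where P: "(\<lambda>m. real (m + 2) * - cmod (a (m + 2)) * r ^ (m + 1)) sums P"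
      "deriv (coanalytic_part a) (of_real r) = of_real P"
      using real_coeffs_sums(2)[OF ds(1) re(1) r1] by blast
    obtain Q where Q: "(\<lambda>m. real (m + 2) * cmod (b (m + 2)) * r ^ (m + 1)) sums Q"
      "deriv (coanalytic_part b) (of_real r) = of_real Q"
      using real_coeffs_sums(2)[OF ds(2) re(2) r1] by blast
    \<comment> \<open>With \<open>h\<close> and \<open>g\<close> the analytic and coanalytic parts,
      \<open>X\<close> is \<open>h' - g'\<close> at \<open>r\<close>; both derivatives are real
      there, so conjugation has no effect.\<close>
    define X where "X = 1 + P - Q"
    have hd: "harmonic_diff (analytic_part a) (coanalytic_part b) (of_real r) = of_real (r * X)"
      using r by (simp add: harmonic_diff_def deriv_analytic_part[OF ds(1)] P(2) Q(2) X_def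
          algebra_simps)
    have "2 * harmonic_diff (analytic_part a) (coanalytic_part b) (of_real r)
        / (f (of_real r) - f (- of_real r)) = of_real (X / y r)"
      using r \<open>0 < y r\<close> by (simp add: fdiff hd field_simps)
    moreover obtain \<zeta> where "cmod \<zeta> < 1"
        "2 * harmonic_diff (analytic_part a) (coanalytic_part b) (of_real r)
          / (f (of_real r) - f (- of_real r)) = (1 + of_real C * \<zeta>) / (1 + of_real D * \<zeta>)"
      using Stau_classD(3)[OF f, of "of_real r"] r by auto
    ultimately have "1 + C < (1 + D) * (X / y r)"
      using real_in_janowski_image[OF CD, of \<zeta> "X / y r"] by simp
    then have ineq: "(1 + C) * y r < (1 + D) * X"
      using \<open>0 < y r\<close> by (simp add: field_simps)
    have "(\<lambda>m. real (m + 2) * - cmod (a (m + 2)) * r ^ (m + 1)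
        - real (m + 2) * cmod (b (m + 2)) * r ^ (m + 1)) sums (P - Q)"
      by (intro sums_diff P Q)
    then have sX: "(\<lambda>m. - (real (m + 2) * p m * r ^ (m + 1))) sums (P - Q)"
      by (simp add: p_def algebra_simps)
    have sy: "(\<lambda>m. r * (c m * r ^ m)) sums (y r - 1)"
      unfolding y_def using r by (auto intro!: sums_mult summable_sums sumc)
    \<comment> \<open>Removing the constant term 1 from both \<open>y r\<close> and \<open>X\<close>
      in \<open>ineq\<close> leaves \<open>(1 + D) - (1 + C) = D - C\<close> as the upper bound for
      this series.\<close>
    have "(\<lambda>m. (1 + C) * (r * (c m * r ^ m)) - (1 + D) * (- (real (m + 2) * p m * r ^ (m + 1))))
        sums ((1 + C) * (y r - 1) - (1 + D) * (P - Q))"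
      by (intro sums_diff sums_mult sX sy)
    then have t: "(\<lambda>m. ((1 + D) * real (m + 2) * p m + (1 + C) * c m) * r ^ (m + 1))
        sums ((1 + C) * (y r - 1) - (1 + D) * (P - Q))"
      by (simp add: algebra_simps)
    \<comment> \<open>The constant \<open>2 * (1 + D)\<close> is the weight at \<open>m = 0\<close>.
      For odd \<open>m\<close> the term \<open>c m\<close> may be as low as \<open>- p m\<close>,
      but then the factor \<open>m + 2\<close> is at least 3, and
      \<open>3 * (1 + D) - (1 + C)\<close> still exceeds \<open>2 * (1 + D)\<close> because
      \<open>C < D\<close>.\<close>
    have le: "2 * (1 + D) * p m \<le> (1 + D) * real (m + 2) * p m + (1 + C) * c m" for m
    proof (cases "odd m")
      case True
      have p: "0 \<le> p m" "- p m \<le> c m"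
        using True by (simp_all add: p_def c_def)
      have "3 \<le> real (m + 2)" using True by (cases m) auto
      then have "(1 + D) * 3 * p m \<le> (1 + D) * real (m + 2) * p m"
        using D p by (intro mult_right_mono mult_left_mono) auto
      moreover have "(1 + C) * (- p m) \<le> (1 + C) * c m"
        using CD p by (intro mult_left_mono) auto
      moreover have "C * p m \<le> D * p m" using CD p by (intro mult_right_mono) auto
      ultimately show ?thesis by (simp add: algebra_simps)
    next
      case False
      have "(1 + D) * 2 * p m \<le> (1 + D) * real (m + 2) * p m"
        using D by (intro mult_right_mono mult_left_mono) (auto simp: p_def)
      with False show ?thesis by (simp add: c_def mult.commute)
    qed
    have sp: "summable (\<lambda>m. p m * r ^ (m + 1))"
      using summable_mult[OF summ[OF r], of r] by (simp add: mult.left_commute)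
    have "(\<lambda>m. 2 * (1 + D) * p m * r ^ (m + 1)) sums (2 * (1 + D) * (\<Sum>m. p m * r ^ (m + 1)))"
      using sums_mult[OF summable_sums[OF sp], of "2 * (1 + D)"] by (simp only: mult.assoc)
    then have "2 * (1 + D) * (\<Sum>m. p m * r ^ (m + 1)) \<le> (1 + C) * (y r - 1) - (1 + D) * (P - Q)"
      by (rule sums_le[OF _ _ t, rotated]) (use le r in \<open>auto intro!: mult_right_mono simp del: power_Suc\<close>)
    also have "\<dots> \<le> D - C" using ineq by (simp add: X_def algebra_simps)
    finally have "(\<Sum>m. p m * r ^ (m + 1)) * (2 * (1 + D)) \<le> D - C" by (simp only: mult.commute)
    then show ?thesis using sp D by (simp add: pos_le_divide_eq del: power_Suc)
  qed
  have p0: "0 \<le> p m" for m by (simp add: p_def)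
  show "summable p" "suminf p \<le> (D - C) / (2 * (1 + D))"
    using Abel_bound[OF p0 key] by auto
qed

section \<open>Growth and covering for perturbations of the identity\<close>

lemma harmonic_expansion_continuous:
  assumes "harmonic_expansion f a b"
  shows "continuous_on (ball 0 1) f"
proof -
  have ds: "disc_summable a" "disc_summable b" using assms by (auto simp: harmonic_expansion_iff)
  have "continuous_on (ball 0 1) (\<lambda>z. z + coanalytic_part a z + cnj (coanalytic_part b z))"
    by (intro continuous_intros continuous_at_imp_continuous_on ballI
        DERIV_isCont[OF coanalytic_part_DERIV(1)[OF ds(1)]]
        DERIV_isCont[OF coanalytic_part_DERIV(1)[OF ds(2)]]) auto
  then show ?thesis
    by (rule continuous_on_eq) (use assms in \<open>auto simp: harmonic_expansion_iff\<close>)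
qed

text \<open>Every exponent is at least 2, so \<open>r ^ (m + 2) \<le> r ^ 2\<close>. The estimate
  serves both for \<open>f z - z\<close> and for the majorant.\<close>

lemma coeff_tail_bound:
  fixes p :: "nat \<Rightarrow> real"
  assumes "\<And>m. 0 \<le> p m" "summable p" "suminf p \<le> K" "0 \<le> r" "r \<le> 1"
  shows "summable (\<lambda>m. p m * r ^ (m + 2))" "(\<Sum>m. p m * r ^ (m + 2)) \<le> K * r ^ 2"
proof -
  have le: "p m * r ^ (m + 2) \<le> p m * r ^ 2" for m
    using assms(1,4,5) by (intro mult_left_mono power_decreasing) auto
  have s: "summable (\<lambda>m. p m * r ^ 2)" by (intro summable_mult2 assms)
  show *: "summable (\<lambda>m. p m * r ^ (m + 2))"
    by (rule summable_comparison_test'[OF s, of 0]) (use le assms(1,4) in auto)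
  have "(\<Sum>m. p m * r ^ (m + 2)) \<le> (\<Sum>m. p m * r ^ 2)"
    by (intro suminf_le le * s)
  also have "\<dots> = suminf p * r ^ 2" by (intro suminf_mult2[symmetric] assms)
  also have "\<dots> \<le> K * r ^ 2" by (intro mult_right_mono assms) auto
  finally show "(\<Sum>m. p m * r ^ (m + 2)) \<le> K * r ^ 2" .
qed

lemma harmonic_expansion_near_id:
  assumes f: "harmonic_expansion f a b" and z: "cmod z < 1"
    and p: "summable (\<lambda>m. cmod (a (m + 2)) + cmod (b (m + 2)))"
      "(\<Sum>m. cmod (a (m + 2)) + cmod (b (m + 2))) \<le> K"
  shows "cmod (f z - z) \<le> K * cmod z ^ 2"
proof -
  have s: "summable (\<lambda>m. a (m + 2) * z ^ (m + 2))" "summable (\<lambda>m. b (m + 2) * z ^ (m + 2))"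
    using f z by (auto simp: harmonic_expansion_def)
  have "(\<lambda>m. a (m + 2) * z ^ (m + 2) + cnj (b (m + 2) * z ^ (m + 2)))
      sums (coanalytic_part a z + cnj (coanalytic_part b z))"
    unfolding coanalytic_part_def by (intro sums_add summable_sums s sums_cnj[THEN iffD2])
  then have "f z - z = (\<Sum>m. a (m + 2) * z ^ (m + 2) + cnj (b (m + 2) * z ^ (m + 2)))"
    using f z by (simp add: harmonic_expansion_iff sums_iff del: power_Suc)
  also have "cmod \<dots> \<le> (\<Sum>m. (cmod (a (m + 2)) + cmod (b (m + 2))) * cmod z ^ (m + 2))"
  proof (rule norm_suminf_le)
    show "cmod (a (m + 2) * z ^ (m + 2) + cnj (b (m + 2) * z ^ (m + 2)))
        \<le> (cmod (a (m + 2)) + cmod (b (m + 2))) * cmod z ^ (m + 2)" for m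
      by (rule order_trans[OF norm_triangle_ineq])
        (simp add: norm_mult norm_power distrib_right del: power_Suc complex_cnj_mult complex_cnj_power)
    show "summable (\<lambda>m. (cmod (a (m + 2)) + cmod (b (m + 2))) * cmod z ^ (m + 2))"
      by (rule coeff_tail_bound(1)[OF _ p]) (use z in auto)
  qed
  also have "\<dots> \<le> K * cmod z ^ 2"
    by (rule coeff_tail_bound(2)[OF _ p]) (use z in auto)
  finally show ?thesis .
qed

lemma ball_subset_image_near_id:
  fixes f :: "'a::euclidean_space \<Rightarrow> 'a"
  assumes f: "continuous_on (ball 0 1) f" and K: "0 \<le> K"
    and near: "\<And>z. norm z < 1 \<Longrightarrow> norm (f z - z) \<le> K * norm z ^ 2"
  shows "ball 0 (1 - K) \<subseteq> f ` ball 0 1"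
proof
  fix w :: 'a assume "w \<in> ball 0 (1 - K)"
  then have w: "norm w + K < 1" by simp
  \<comment> \<open>Since \<open>norm (f z - z) \<le> K\<close> on the disc, the map
    \<open>z \<mapsto> w + z - f z\<close> takes values of norm at most \<open>norm w + K\<close>.
    As this is below 1, the closed ball of that radius lies in the domain and is mapped into
    itself.\<close>
  define \<rho> where "\<rho> = norm w + K"
  have sub: "cball 0 \<rho> \<subseteq> (ball 0 1 :: 'a set)" using w by (auto simp: \<rho>_def)
  have "continuous_on (cball 0 \<rho>) (\<lambda>z. w + z - f z)"
    by (intro continuous_intros continuous_on_subset[OF f sub])
  moreover have "w + z - f z \<in> cball 0 \<rho>" if "z \<in> cball 0 \<rho>" for z
  proof -
    have z: "norm z < 1" using sub that by auto
    have "norm (w + z - f z) \<le> norm w + norm (f z - z)"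
      using norm_triangle_ineq4[of w "f z - z"] by (simp add: algebra_simps)
    also have "norm (f z - z) \<le> K * norm z ^ 2" by (rule near[OF z])
    also have "\<dots> \<le> K * 1" using z K by (intro mult_left_mono) (auto simp: power_le_one)
    finally show ?thesis by (simp add: \<rho>_def)
  qed
  moreover have "cball (0::'a) \<rho> \<noteq> {}" using K norm_ge_zero[of w] by (simp add: \<rho>_def not_less del: norm_ge_zero)
  ultimately obtain z where z: "z \<in> cball 0 \<rho>" "w + z - f z = z"
    using brouwer[OF compact_cball convex_cball] by blast
  from z(2) have "w = f z" by (simp add: algebra_simps)
  then show "w \<in> f ` ball 0 1" using sub z(1) by blast
qed

text \<open>The covered ball of radius \<open>1 - K\<close> is open, so it lies in the interior of
  the image and contains no frontier point. Boundedness of the image ensures a nonempty frontier,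
  which excludes the default value 0 of \<open>infdist\<close>.\<close>

lemma boundary_dist_near_id:
  assumes f: "continuous_on (ball 0 1) f" and K: "0 \<le> K" and f0: "f 0 = 0"
    and near: "\<And>z. cmod z < 1 \<Longrightarrow> cmod (f z - z) \<le> K * cmod z ^ 2"
  shows "1 - K \<le> boundary_dist f"
proof -
  have "f ` ball 0 1 \<subseteq> cball 0 (1 + K)"
  proof safe
    fix z :: complex assume "z \<in> ball 0 1"
    then have z: "cmod z < 1" by simp
    have "cmod (f z) \<le> cmod z + cmod (f z - z)"
      using norm_triangle_ineq[of z "f z - z"] by simp
    also have "cmod (f z - z) \<le> K * 1"
      using z K by (intro order_trans[OF near[OF z]] mult_left_mono) (auto simp: power_le_one)
    finally show "f z \<in> cball 0 (1 + K)" using z by simp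
  qed
  then have "bounded (f ` ball 0 1)" using bounded_cball bounded_subset by blast
  then have "frontier (f ` ball 0 1) \<noteq> {}"
    by (auto simp: frontier_eq_empty not_bounded_UNIV)
  moreover have "1 - K \<le> dist 0 w" if "w \<in> frontier (f ` ball 0 1)" for w
  proof (rule ccontr)
    assume "\<not> 1 - K \<le> dist 0 w"
    then have "w \<in> interior (f ` ball 0 1)"
      using interior_maximal[OF ball_subset_image_near_id[OF f K near] open_ball] by auto
    then show False using that by (simp add: frontier_def)
  qed
  ultimately show ?thesis
    unfolding boundary_dist_def f0 by (simp add: infdist_notempty cINF_greatest)
qed

section \<open>The radius and the extremal function\<close>

lemma r_star_props:
  assumes "- D \<le> C" "C < D" "D \<le> 1"
  defines "k \<equiv> (D - C) / (2 * (1 + D))"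
  shows "0 < k" "k \<le> 1 / 2" "0 \<le> r_star C D" "r_star C D < 1"
    "r_star C D + k * r_star C D ^ 2 = 1 - k"
proof -
  have D: "0 < D" using assms by simp
  \<comment> \<open>The bound \<open>k \<le> 1 / 2\<close> amounts to \<open>- 1 \<le> C\<close>,
    which follows from \<open>- D \<le> C\<close> and \<open>D \<le> 1\<close>.\<close>
  show k: "0 < k" "k \<le> 1 / 2" using assms D by (auto simp: k_def field_simps)
  define s where "s = sqrt (1 + 4 * k * (1 - k))"
  have s2: "s ^ 2 = 1 + 4 * k * (1 - k)" using k by (simp add: s_def)
  have r: "r_star C D = (s - 1) / (2 * k)"
    unfolding r_star_def alpha2_def s_def k_def by simp
  have "1 \<le> s" using k by (simp add: s_def)
  then show "0 \<le> r_star C D" using k by (simp add: r)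
  show eq: "r_star C D + k * r_star C D ^ 2 = 1 - k"
  proof -
    have "s = 2 * k * r_star C D + 1" using k(1) by (simp add: r)
    with s2 have "(4 * k) * (r_star C D + k * r_star C D ^ 2) = (4 * k) * (1 - k)"
      by (simp add: power2_eq_square algebra_simps)
    then show ?thesis using k(1) by simp
  qed
  show "r_star C D < 1"
  proof (rule ccontr)
    assume "\<not> r_star C D < 1"
    \<comment> \<open>At any radius from 1 on, the left side of the equation is at least
      \<open>1 + k\<close>, more than \<open>1 - k\<close>.\<close>
    then have "1 + k * 1 \<le> r_star C D + k * r_star C D ^ 2"
      using k by (intro add_mono mult_left_mono) auto
    then show False using eq k by simp
  qed
qed

lemma extremal_expansion:
  fixes C D :: real
  defines "e \<equiv> \<lambda>m::nat. if m = 2 then - complex_of_real ((D - C) / (2 * (1 + D))) else 0"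
  shows "analytic_part e = extremal_fun C D" "coanalytic_part (\<lambda>_. 0) = (\<lambda>_. 0)"
    "harmonic_expansion (extremal_fun C D) e (\<lambda>_. 0)"
proof -
  have *: "(\<lambda>m. e (m + 2) * z ^ (m + 2))
      sums (- complex_of_real ((D - C) / (2 * (1 + D))) * z ^ 2)" for z
    using sums_finite[of "{0}" "\<lambda>m. e (m + 2) * z ^ (m + 2)"] by (simp add: e_def power2_eq_square)
  show 1: "analytic_part e = extremal_fun C D"
    using * by (simp add: fun_eq_iff analytic_part_def extremal_fun_def sums_iff)
  show 2: "coanalytic_part (\<lambda>_. 0) = (\<lambda>_. 0)" by (simp add: fun_eq_iff coanalytic_part_def)
  show "harmonic_expansion (extremal_fun C D) e (\<lambda>_. 0)"
    using * by (auto simp: harmonic_expansion_def 1 2 sums_iff)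
qed

text \<open>Here \<open>f z - f (- z) = 2 * z\<close>, so the quotient is
  \<open>1 - 2 * k * z\<close>. It stays in the disc about 1 of radius
  \<open>2 * k = (D - C) / (1 + D)\<close>, which is the distance from 1 to the boundary value
  \<open>(1 + C) / (1 + D)\<close>.\<close>

lemma extremal_in_Stau_class:
  assumes "- D \<le> C" "C < D" "D \<le> 1"
  shows "extremal_fun C D \<in> Stau_class C D"
proof -
  define k where "k = (D - C) / (2 * (1 + D))"
  define e where "e = (\<lambda>m::nat. if m = 2 then - complex_of_real k else 0)"
  note k = r_star_props(1,2)[OF assms, folded k_def]
  have D: "0 < D" using assms by simp
  have ex: "harmonic_expansion (extremal_fun C D) e (\<lambda>_. 0)"
    and an: "analytic_part e = (\<lambda>z. z - of_real k * z ^ 2)" "coanalytic_part (\<lambda>_. 0) = (\<lambda>_. 0)"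
    and f: "extremal_fun C D = (\<lambda>z. z - of_real k * z ^ 2)"
    using extremal_expansion(1,3)[where C = C and D = D] extremal_expansion(2)
    unfolding e_def k_def extremal_fun_def[abs_def] by simp_all
  have tau: "extremal_fun C D \<in> tau_class"
  proof -
    have "\<forall>m\<ge>2. e m = - of_real (cmod (e m)) \<and> (0::complex) = of_real (cmod 0)"
      using k(1) by (auto simp: e_def)
    with ex show ?thesis unfolding tau_class_def by blast
  qed
  have hd: "harmonic_diff (analytic_part e) (coanalytic_part (\<lambda>_. 0)) z = z * (1 - 2 * of_real k * z)"
    for z
  proof -
    have "((\<lambda>z. z - complex_of_real k * z ^ 2) has_field_derivative 1 - 2 * of_real k * z) (at z)"
      by (auto intro!: derivative_eq_intros)
    then show ?thesis by (simp add: harmonic_diff_def an DERIV_imp_deriv)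
  qed
  have fd: "extremal_fun C D z - extremal_fun C D (- z) = 2 * z" for z
    by (simp add: f)
  have "1 - 2 * of_real k * z \<in> (\<lambda>z. (1 + complex_of_real C * z) / (1 + complex_of_real D * z)) ` ball 0 1"
    if z: "cmod z < 1" for z
  proof
    text \<open>\<open>\<zeta>\<close> solves \<open>(1 + C * \<zeta>) / (1 + D * \<zeta>) = 1 - 2 * k * z\<close>.\<close>
    define d where "d = D - C - 2 * k * D * z"
    define \<zeta> where "\<zeta> = 2 * k * z / d"
    \<comment> \<open>This rearranges to
      \<open>2 * k * cmod z < (D - C) - 2 * k * D * cmod z\<close>, whose right side is a lower
      bound for \<open>cmod d\<close>; hence \<open>cmod \<zeta> < 1\<close>.\<close>
    have "2 * k * (1 + D) * cmod z < D - C"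
    proof -
      have "2 * k * (1 + D) = D - C" using D by (simp add: k_def field_simps)
      then show ?thesis using z assms(2) by simp
    qed
    then have "2 * k * cmod z < (D - C) - 2 * k * D * cmod z" by (simp add: algebra_simps)
    also have "\<dots> = cmod (complex_of_real (D - C)) - cmod (2 * k * D * z)"
      using k D assms(2) by (simp only: norm_of_real norm_mult) simp
    also have "\<dots> \<le> cmod d"
      using norm_triangle_ineq2[of "complex_of_real (D - C)" "2 * k * D * z"] by (simp add: d_def)
    finally have less: "2 * k * cmod z < cmod d" .
    then have d: "d \<noteq> 0" using k by (auto simp: mult_less_0_iff)
    have "cmod \<zeta> < 1" using less k by (simp add: \<zeta>_def norm_divide norm_mult divide_less_eq_1)
    then show "\<zeta> \<in> ball 0 1" by simp
    have dz: "d * \<zeta> = 2 * k * z" using d by (simp add: \<zeta>_def)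
    have lin: "d * (1 + x * \<zeta>) = d + x * (2 * k * z)" for x
      unfolding dz[symmetric] by (simp add: algebra_simps)
    have "d * (1 + D * \<zeta>) = D - C" "d * (1 + C * \<zeta>) = (D - C) * (1 - 2 * k * z)"
      unfolding lin by (simp_all add: d_def algebra_simps)
    moreover have "(1 + C * \<zeta>) / (1 + D * \<zeta>) = (d * (1 + C * \<zeta>)) / (d * (1 + D * \<zeta>))"
      using d by simp
    ultimately show "1 - 2 * of_real k * z = (1 + of_real C * \<zeta>) / (1 + of_real D * \<zeta>)"
      using assms(2) by simp
  qed
  then have "subordinate
       (\<lambda>z. if z = 0 then 1 else 2 * harmonic_diff (analytic_part e) (coanalytic_part (\<lambda>_. 0)) z
            / (extremal_fun C D z - extremal_fun C D (- z)))
       (\<lambda>z. (1 + complex_of_real C * z) / (1 + complex_of_real D * z))"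
    unfolding subordinate_def hd fd
    by (auto intro: image_eqI[of _ _ 0])
  then have "extremal_fun C D \<in> SH_class C D"
    using ex fd unfolding SH_class_def harmonic_class_def by fastforce
  with tau show ?thesis by (simp add: Stau_class_def)
qed

lemma boundary_dist_extremal_le:
  assumes "- D \<le> C" "C < D" "D \<le> 1"
  shows "boundary_dist (extremal_fun C D) \<le> 1 - (D - C) / (2 * (1 + D))"
proof -
  define k where "k = (D - C) / (2 * (1 + D))"
  note k = r_star_props(1,2)[OF assms, folded k_def]
  have f: "extremal_fun C D = (\<lambda>z. z - of_real k * z ^ 2)"
    by (simp add: fun_eq_iff extremal_fun_def k_def)
  let ?f = "extremal_fun C D"
  have "?f 1 \<in> ?f ` closure (ball 0 1)" by simp
  also have "\<dots> \<subseteq> closure (?f ` ball 0 1)"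
    by (rule image_closure_subset) (auto simp: f intro!: continuous_intros closure_subset[THEN subsetD])
  finally have "?f 1 \<in> closure (?f ` ball 0 1)" .
  moreover have "?f 1 \<notin> ?f ` ball 0 1"
  proof
    assume "?f 1 \<in> ?f ` ball 0 1"
    then obtain z where z: "cmod z < 1" "?f 1 = ?f z" by auto
    \<comment> \<open>The equation \<open>f 1 = f z\<close> factors. The second factor cannot
      vanish, since \<open>cmod (k * (1 + z)) < 2 * k \<le> 1\<close>.\<close>
    then have "(1 - z) * (1 - of_real k * (1 + z)) = 0"
      by (simp add: f algebra_simps power2_eq_square)
    moreover have "1 - z \<noteq> 0" using z by auto
    moreover have "cmod (of_real k * (1 + z)) < 1"
    proof -
      have "cmod (1 + z) < 2" using norm_triangle_ineq[of 1 z] z by simp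
      then have "k * cmod (1 + z) < k * 2" using k(1) by simp
      also have "\<dots> \<le> 1" using k by simp
      finally show ?thesis using k(1) by (simp add: norm_mult)
    qed
    ultimately show False by auto
  qed
  ultimately have "?f 1 \<in> frontier (?f ` ball 0 1)"
    using interior_subset by (auto simp: frontier_def)
  then have "boundary_dist ?f \<le> dist (?f 0) (?f 1)"
    unfolding boundary_dist_def by (rule infdist_le)
  also have "\<dots> = 1 - k" 
  proof -
    have "?f 0 = 0" "?f 1 = of_real (1 - k)" by (simp_all add: f)
    then show ?thesis using k by (simp only: dist_0_norm norm_of_real)
  qed
  finally show ?thesis by (simp add: k_def)
qed

text \<open>By uniqueness, any expansion of the extremal function has only one nonzero coefficient
  of index at least 2.\<close>

lemma majorant_extremal:
  assumes "- D \<le> C" "C < D" "D \<le> 1" "harmonic_expansion (extremal_fun C D) a b"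
  shows "majorant a b z = cmod z + (D - C) / (2 * (1 + D)) * cmod z ^ 2"
proof -
  define k where "k = (D - C) / (2 * (1 + D))"
  have eq: "a (m + 2) = (if m = 0 then - of_real k else 0)" "b (m + 2) = 0" for m
    using harmonic_expansion_unique[OF assms(4) extremal_expansion(3), of "m + 2"]
    by (auto simp: k_def)
  have eq': "cmod (a (m + 2)) + cmod (b (m + 2)) = (if m = 0 then k else 0)" for m
    unfolding eq using r_star_props(1)[OF assms(1-3), folded k_def] by simp
  have "(\<lambda>m. (if m = 0 then k else 0) * cmod z ^ (m + 2)) sums (k * cmod z ^ 2)"
    using sums_finite[of "{0}" "\<lambda>m. (if m = 0 then k else 0) * cmod z ^ (m + 2)"]
    by (simp add: power2_eq_square)
  then show ?thesis unfolding majorant_def eq' by (simp add: sums_iff k_def)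
qed

theorem theorem2p4:
  fixes C D :: real
  assumes "- D \<le> C" and "C < D" and "D \<le> 1"
  shows "(\<forall>f a b. f \<in> Stau_class C D \<longrightarrow> harmonic_expansion f a b \<longrightarrow>
            (\<forall>z r. cmod z = r \<longrightarrow> r < 1 \<longrightarrow>
               r - (D - C) / (2 * (1 + D)) * r ^ 2 \<le> cmod (f z) \<and>
               cmod (f z) \<le> r + (D - C) / (2 * (1 + D)) * r ^ 2) \<and>
            (\<forall>z. cmod z \<le> r_star C D \<longrightarrow>
               cmod z + (\<Sum>m. (cmod (a (m + 2)) + cmod (b (m + 2))) * cmod z ^ (m + 2))
                 \<le> infdist (f 0) (frontier (f ` ball 0 1)))) \<and>
         is_Bohr_radius (Stau_class C D) (r_star C D) \<and>
         extremal_fun C D \<in> Stau_class C D \<and>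
         (\<forall>a b. harmonic_expansion (extremal_fun C D) a b \<longrightarrow>
            (\<forall>z. cmod z = r_star C D \<longrightarrow>
               majorant a b z = boundary_dist (extremal_fun C D)) \<and>
            (\<forall>z\<in>ball 0 1. r_star C D < cmod z \<longrightarrow>
               boundary_dist (extremal_fun C D) < majorant a b z))"
proof -
  define k where "k = (D - C) / (2 * (1 + D))"
  define R where "R = r_star C D"
  let ?f = "extremal_fun C D"
  note R = r_star_props[OF assms, folded k_def R_def]
  have near: "cmod (f z - z) \<le> k * cmod z ^ 2"
    if "f \<in> Stau_class C D" "harmonic_expansion f a b" "cmod z < 1" for f a b z
    using harmonic_expansion_near_id[OF that(2,3) Stau_coeff_bound[OF assms that(1,2)]]
    by (simp add: k_def)
  have growth: "cmod z - k * cmod z ^ 2 \<le> cmod (f z) \<and> cmod (f z) \<le> cmod z + k * cmod z ^ 2"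
    if "f \<in> Stau_class C D" "harmonic_expansion f a b" "cmod z < 1" for f a b z
    using near[OF that] norm_triangle_ineq2[of z "z - f z"] norm_triangle_ineq[of z "f z - z"]
    by (simp add: norm_minus_commute)
  have dist: "1 - k \<le> boundary_dist f"
    if "f \<in> Stau_class C D" "harmonic_expansion f a b" for f a b
    \<comment> \<open>At \<open>z = 0\<close> the bound \<open>near\<close> yields
      \<open>f 0 = 0\<close>.\<close>
    using boundary_dist_near_id[OF harmonic_expansion_continuous[OF that(2)] _ _ near[OF that]]
      near[OF that, of 0] R(1) by simp
  have mono: "r + k * r ^ 2 \<le> 1 - k" if "0 \<le> r" "r \<le> R" for r
  proof -
    have "r + k * r ^ 2 \<le> R + k * R ^ 2"
      using that R(1) by (intro add_mono mult_left_mono power_mono) auto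
    then show ?thesis using R(5) by simp
  qed
  have Bohr: "majorant a b z \<le> boundary_dist f"
    if "f \<in> Stau_class C D" "harmonic_expansion f a b" "cmod z \<le> R" for f a b z
  proof -
    have "(\<Sum>m. (cmod (a (m + 2)) + cmod (b (m + 2))) * cmod z ^ (m + 2)) \<le> k * cmod z ^ 2"
      unfolding k_def
      by (rule coeff_tail_bound(2)[OF _ Stau_coeff_bound[OF assms that(1,2)]])
        (use that(3) R(4) in auto)
    then have "majorant a b z \<le> cmod z + k * cmod z ^ 2" by (simp add: majorant_def)
    also have "\<dots> \<le> 1 - k" using mono that(3) by simp
    also have "\<dots> \<le> boundary_dist f" by (rule dist[OF that(1,2)])
    finally show ?thesis .
  qed
  note ext = extremal_in_Stau_class[OF assms]
  obtain a0 b0 where ex0: "harmonic_expansion ?f a0 b0" using extremal_expansion(3) by blast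
  \<comment> \<open>The covering bound and the unattained boundary value \<open>1 - k\<close>
    meet.\<close>
  have dist_ext: "boundary_dist ?f = 1 - k"
    using dist[OF ext ex0] boundary_dist_extremal_le[OF assms] by (simp add: k_def)
  have sharp: "boundary_dist ?f < majorant a b z"
    if "harmonic_expansion ?f a b" "R < cmod z" for a b z
  proof -
    have "R + k * R ^ 2 < cmod z + k * cmod z ^ 2"
      using that(2) R(1,3) by (intro add_less_le_mono mult_left_mono power_mono) auto
    then show ?thesis
      using majorant_extremal[OF assms that(1)] R(5) dist_ext by (simp add: k_def)
  qed
  have attained: "majorant a b z = boundary_dist ?f"
    if "harmonic_expansion ?f a b" "cmod z = R" for a b z
    using majorant_extremal[OF assms that(1)] R(5) dist_ext that(2) by (simp add: k_def)
  have "R' \<le> R" if R': "R' \<in> {0..1}" "Bohr_inequality_upto (Stau_class C D) R'" for R'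
  proof (rule ccontr)
    assume "\<not> R' \<le> R"
    \<comment> \<open>An intermediate \<open>r\<close> is below 1 even when \<open>R' = 1\<close>,
      so it is a point of the open disc at which the assumed inequality contradicts
      \<open>sharp\<close>.\<close>
    then obtain r where r: "R < r" "r < R'" using dense[of R R'] by auto
    then have "majorant a0 b0 (of_real r) \<le> boundary_dist ?f"
      using R' R(3) ext ex0 by (auto simp: Bohr_inequality_upto_def)
    moreover have "boundary_dist ?f < majorant a0 b0 (of_real r)"
      using r R(3) by (intro sharp ex0) auto
    ultimately show False by simp
  qed
  moreover have "Bohr_inequality_upto (Stau_class C D) R"
    unfolding Bohr_inequality_upto_def by (intro ballI allI impI) (rule Bohr)
  moreover have "R \<in> {0..1}" using R(3,4) by simp
  ultimately have radius: "is_Bohr_radius (Stau_class C D) R"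
    unfolding is_Bohr_radius_def by blast
  show ?thesis
    unfolding k_def[symmetric] R_def[symmetric]
  proof (intro conjI allI impI ballI radius ext)
    fix f a b z r
    assume f: "f \<in> Stau_class C D" "harmonic_expansion f a b" and "cmod z = r" "r < 1"
    then show "r - k * r ^ 2 \<le> cmod (f z)" "cmod (f z) \<le> r + k * r ^ 2"
      using growth[OF f, of z] by auto
  next
    fix f a b z
    assume "f \<in> Stau_class C D" "harmonic_expansion f a b" "cmod z \<le> R"
    from Bohr[OF this]
    show "cmod z + (\<Sum>m. (cmod (a (m + 2)) + cmod (b (m + 2))) * cmod z ^ (m + 2))
        \<le> infdist (f 0) (frontier (f ` ball 0 1))"
      unfolding majorant_def boundary_dist_def .
  qed (rule attained sharp; assumption)+
qed

end
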